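(* Let $g:\mathbb{R}^d\to\mathbb{R}^d$ be differentiable with $g(x^\ast)=0$, let $R$ be a positive semidefinite $d\times d$ real matrix (not assumed invertible), and let $\alpha_M>0$. Assume there exist constants $\beta,\omega_L,M_I,\varepsilon_1>0$ such that for all $\alpha$ with $0<\alpha<\alpha_M$ and all $x\in B(x^\ast,\varepsilon_1)$: (1) $\|g'(x)-g'(y)\|\le\omega_L\|x-y\|$ for all $y\in B(x^\ast,\varepsilon_1)$; (2) $\alpha R+g'(x)$ is invertible; (3) $\|(\alpha R+g'(x))^{-1}\|\le M_I$; (4) $\|(\alpha R+g'(x))^{-1}(\alpha R)\|\le \dfrac{\alpha/\beta}{1+\alpha/\beta}$. Then there is $\varepsilon_E>0$ such that for every starting point $x^0\in B(x^\ast,\varepsilon_E)$ and every sequence $(\alpha_n)_{n\ge0}$ with $0<\alpha_n<\alpha_M$ for all $n$, the regularized iteration $$x^{n+1}-x^n=-(\alpha_nR+g'(x^n))^{-1}g(x^n),\qquad n\ge 0,$$ converges $q$-linearly to $x^\ast$.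
   Context: $\|\cdot\|$ is a fixed norm on $\mathbb{R}^d$ and also the induced operator norm on matrices; $g'(x)$ is the Jacobian of $g$ at $x$; $B(x^\ast,\varepsilon)=\{x:\|x-x^\ast\|<\varepsilon\}$. A sequence $(x^n)$ converges $q$-linearly to $x^\ast$ if $x^n\to x^\ast$ and there is $\rho\in(0,1)$ with $\|x^{n+1}-x^\ast\|\le\rho\|x^n-x^\ast\|$ for all $n$. *)

theory Defs
  imports "HOL-Analysis.Analysis"
begin

text \<open>
  The norm on \<open>\<real>\<^sup>d\<close> is arbitrary, whereas the class instance \<^const>\<open>norm\<close> on
  \<^typ>\<open>real ^ 'd\<close> is Euclidean. Hence the norm is a parameter \<open>N\<close>, and the ball, the
  induced operator norm and the mode of convergence are all taken with respect to \<open>N\<close>.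
\<close>

definition is_norm :: "(real ^ 'd \<Rightarrow> real) \<Rightarrow> bool" where
  "is_norm N \<longleftrightarrow>
     (\<forall>x. 0 \<le> N x) \<and> (\<forall>x. N x = 0 \<longleftrightarrow> x = 0) \<and>
     (\<forall>c x. N (c *\<^sub>R x) = \<bar>c\<bar> * N x) \<and> (\<forall>x y. N (x + y) \<le> N x + N y)"

definition ball_wrt :: "(real ^ 'd \<Rightarrow> real) \<Rightarrow> real ^ 'd \<Rightarrow> real \<Rightarrow> (real ^ 'd) set" where
  "ball_wrt N c r = {x. N (x - c) < r}"

text \<open>Same shape as \<^const>\<open>onorm\<close>; the term for \<open>x = 0\<close> is \<open>0 / 0 = 0\<close> and is harmless.\<close>

definition op_norm :: "(real ^ 'd \<Rightarrow> real) \<Rightarrow> real ^ 'd ^ 'd \<Rightarrow> real" where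
  "op_norm N A = (SUP x. N (A *v x) / N x)"

text \<open>Only the quadratic form is constrained; symmetry is not required.\<close>

definition pos_semidef :: "real ^ 'd ^ 'd \<Rightarrow> bool" where
  "pos_semidef R \<longleftrightarrow> (\<forall>x. 0 \<le> x \<bullet> (R *v x))"

definition q_linearly_converges ::
    "(real ^ 'd \<Rightarrow> real) \<Rightarrow> (nat \<Rightarrow> real ^ 'd) \<Rightarrow> real ^ 'd \<Rightarrow> bool" where
  "q_linearly_converges N X L \<longleftrightarrow>
     (\<lambda>n. N (X n - L)) \<longlonglongrightarrow> 0 \<and>
     (\<exists>\<rho>. 0 < \<rho> \<and> \<rho> < 1 \<and> (\<forall>n. N (X (Suc n) - L) \<le> \<rho> * N (X n - L)))"

text \<open>The matrix \<open>\<alpha> R + g'(x)\<close>.\<close>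

definition reg_jacobian ::
    "(real ^ 'd \<Rightarrow> real ^ 'd) \<Rightarrow> real ^ 'd ^ 'd \<Rightarrow> real \<Rightarrow> real ^ 'd \<Rightarrow> real ^ 'd ^ 'd" where
  "reg_jacobian g R \<alpha> x = \<alpha> *\<^sub>R R + jacobian g (at x)"

end

theory Submission
  imports Defs
begin

text \<open>
  Write \<open>S = \<alpha> R + g'(x)\<close> and \<open>e = x - xs\<close>. Since \<open>g xs = 0\<close>, one step of the iteration turns
  the error \<open>e\<close> into

    \<open>e - S\<inverse> g(x) = S\<inverse> (\<alpha> R) e + S\<inverse> (g(xs) - g(x) - g'(x) (xs - x))\<close>.

  The first summand is the price of regularizing. Its factor is at most
  \<open>\<alpha> / (\<alpha> + \<beta>)\<close>, and as \<open>\<alpha>\<close> stays below \<open>\<alpha>\<^sub>M\<close>, this is at most the fixed number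
  \<open>\<theta> = \<alpha>\<^sub>M / (\<alpha>\<^sub>M + \<beta>) < 1\<close>. The second is the error of linearizing \<open>g\<close>, which is
  quadratic in \<open>e\<close> because the Jacobian is Lipschitz. So the error obeys
  \<open>N e' \<le> \<theta> * N e + K * (N e)\<^sup>2\<close> (lemma \<open>regularized_newton_step\<close>), and in a ball so small that
  \<open>K * N e \<le> (1 - \<theta>) / 2\<close> every step contracts by \<open>\<rho> = (1 + \<theta>) / 2\<close>, whatever the
  parameters \<open>\<alpha>\<^sub>n\<close> are. In particular the iterates never leave that ball.

  The size of \<open>K\<close> is irrelevant, which is why the linearization error may be estimated in the
  Euclidean norm, where the mean value inequality is at hand, and then carried over to \<open>N\<close> by
  equivalence of norms. Only the factor \<open>\<theta>\<close> has to be measured in \<open>N\<close> itself.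
\<close>

lemma is_normD:
  assumes "is_norm N"
  shows "0 \<le> N x" "N x = 0 \<longleftrightarrow> x = 0" "N (c *\<^sub>R x) = \<bar>c\<bar> * N x" "N (x + y) \<le> N x + N y"
  using assms unfolding is_norm_def by auto

lemma is_norm_minus:
  assumes "is_norm N"
  shows "N (- x) = N x"
  using is_normD(3)[OF assms, of "-1" x] by simp

lemma is_norm_sum_le:
  assumes "is_norm N" "finite A"
  shows "N (sum f A) \<le> (\<Sum>i\<in>A. N (f i))"
  using assms(2)
proof (induction A rule: finite_induct)
  case empty
  then show ?case using is_normD(2)[OF assms(1), of 0] by simp
next
  case (insert a A)
  then show ?case using is_normD(4)[OF assms(1), of "f a" "sum f A"] by simp
qed

lemma is_norm_le_norm:
  fixes N :: "real ^ 'd \<Rightarrow> real"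
  assumes "is_norm N"
  obtains C where "C > 0" "\<And>x. N x \<le> C * norm x"
proof
  let ?C = "\<Sum>i\<in>UNIV. N (axis i (1::real))"
  show "0 < ?C + 1"
    by (intro add_nonneg_pos sum_nonneg is_normD(1)[OF assms]) simp
  fix x :: "real ^ 'd"
  have "N x = N (\<Sum>i\<in>UNIV. (x $ i) *\<^sub>R axis i 1)"
    using basis_expansion[of x] by (simp add: scalar_mult_eq_scaleR)
  also have "\<dots> \<le> (\<Sum>i\<in>UNIV. N ((x $ i) *\<^sub>R axis i 1))"
    by (rule is_norm_sum_le[OF assms]) simp
  also have "\<dots> = (\<Sum>i\<in>UNIV. \<bar>x $ i\<bar> * N (axis i (1::real)))"
    by (simp add: is_normD(3)[OF assms])
  also have "\<dots> \<le> (\<Sum>i\<in>UNIV. norm x * N (axis i (1::real)))"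
    by (intro sum_mono mult_right_mono component_le_norm_cart is_normD(1)[OF assms])
  also have "\<dots> = ?C * norm x"
    by (simp add: sum_distrib_left mult.commute)
  also have "\<dots> \<le> (?C + 1) * norm x"
    by (simp add: mult_right_mono)
  finally show "N x \<le> (?C + 1) * norm x" .
qed

text \<open>
  The upper bound makes \<open>N\<close> Lipschitz, hence continuous, for the Euclidean topology, so \<open>N\<close>
  attains a minimum on the compact unit sphere, and definiteness makes the minimum positive.
\<close>

lemma norm_le_is_norm:
  fixes N :: "real ^ 'd \<Rightarrow> real"
  assumes "is_norm N"
  obtains c where "c > 0" "\<And>x. norm x \<le> c * N x"
proof -
  obtain C where C: "C > 0" "\<And>x. N x \<le> C * norm x"
    using is_norm_le_norm[OF assms] by blast
  have "C-lipschitz_on (sphere 0 1) N"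
  proof (rule lipschitz_onI)
    fix x y :: "real ^ 'd"
    have "N x \<le> N y + N (x - y)" "N y \<le> N x + N (x - y)"
      using is_normD(4)[OF assms, of y "x - y"] is_normD(4)[OF assms, of x "y - x"]
        is_norm_minus[OF assms, of "x - y"] by simp_all
    then show "dist (N x) (N y) \<le> C * dist x y"
      using C(2)[of "x - y"] by (simp add: dist_norm)
  qed (use C in simp)
  then have "continuous_on (sphere 0 1) N"
    by (rule lipschitz_on_continuous_on)
  then obtain u where u: "u \<in> sphere 0 1" "\<And>x. x \<in> sphere 0 1 \<Longrightarrow> N u \<le> N x"
    using continuous_attains_inf[of "sphere 0 1" N] by auto
  have "N u > 0"
    using is_normD(1,2)[OF assms, of u] u(1) by auto
  have "norm x \<le> (1 / N u) * N x" for x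
  proof (cases "x = 0")
    case False
    then have "N u \<le> N ((1 / norm x) *\<^sub>R x)"
      by (intro u(2)) simp
    also have "\<dots> = N x / norm x"
      by (simp add: is_normD(3)[OF assms])
    finally show ?thesis
      using False \<open>N u > 0\<close> by (simp add: field_simps)
  qed (simp add: is_normD(1)[OF assms] \<open>N u > 0\<close> less_imp_le)
  then show thesis using that[of "1 / N u"] \<open>N u > 0\<close> by simp
qed

text \<open>
  In finite dimension the quotients in the definition of the operator norm are bounded above, so
  the supremum is a genuine one and bounds each of them.
\<close>

lemma op_norm_bound:
  fixes N :: "real ^ 'd \<Rightarrow> real"
  assumes "is_norm N"
  shows "N (A *v x) \<le> op_norm N A * N x"
proof (cases "x = 0")
  case True
  then show ?thesis using is_normD(2)[OF assms, of 0] by simp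
next
  case False
  obtain C where C: "C > 0" "\<And>x. N x \<le> C * norm x"
    using is_norm_le_norm[OF assms] by blast
  obtain c where c: "c > 0" "\<And>x. norm x \<le> c * N x"
    using norm_le_is_norm[OF assms] by blast
  obtain K where K: "K > 0" "\<And>x. norm (A *v x) \<le> norm x * K"
    using bounded_linear.pos_bounded[OF matrix_vector_mul_bounded_linear[of A]] by blast
  have "N (A *v y) / N y \<le> C * K * c" for y
  proof (cases "y = 0")
    case False
    then have "N y > 0"
      using is_normD(1,2)[OF assms, of y] by linarith
    have "N (A *v y) \<le> C * norm (A *v y)" by (rule C)
    also have "\<dots> \<le> C * (norm y * K)"
      using K C by simp
    also have "\<dots> \<le> C * ((c * N y) * K)"
      using K C c by simp
    finally show ?thesis
      using \<open>N y > 0\<close> by (simp add: pos_divide_le_eq ac_simps)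
  qed (use C c K is_normD(2)[OF assms, of 0] in simp)
  then have "bdd_above (range (\<lambda>y. N (A *v y) / N y))"
    by (intro bdd_aboveI[of _ "C * K * c"]) auto
  then have "N (A *v x) / N x \<le> op_norm N A"
    unfolding op_norm_def by (rule cSUP_upper2) auto
  moreover have "N x > 0"
    using is_normD(1,2)[OF assms, of x] False by linarith
  ultimately show ?thesis
    by (simp add: pos_divide_le_eq)
qed

lemma op_norm_bound_le:
  assumes "is_norm N" "op_norm N A \<le> a"
  shows "N (A *v x) \<le> a * N x"
  using op_norm_bound[OF assms(1), of A x] mult_right_mono[OF assms(2) is_normD(1)[OF assms(1)]]
  by (rule order_trans)

text \<open>
  The map \<open>y \<mapsto> g(y) - g'(x) y\<close> has derivative \<open>g'(y) - g'(x)\<close>. On the segment from \<open>x\<close> to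
  \<open>z\<close> its size is at most \<open>\<omega> * N (x - z)\<close>, up to the constants that compare \<open>N\<close> with the
  Euclidean norm, so the mean value inequality gives a bound quadratic in \<open>x - z\<close>. Those
  constants depend on \<open>N\<close> alone, so one \<open>K\<close> serves all \<open>g\<close>, \<open>\<omega>\<close>, \<open>x\<close> and \<open>z\<close>.
\<close>

lemma linearization_error_quadratic:
  fixes N :: "real ^ 'd \<Rightarrow> real"
  assumes "is_norm N"
  obtains K where "K > 0"
    "\<And>(g :: real ^ 'd \<Rightarrow> real ^ 'd) \<omega> x z r.
      \<lbrakk>\<And>y. g differentiable (at y); \<omega> > 0; x \<in> ball_wrt N z r;
       \<And>y. y \<in> ball_wrt N z r \<Longrightarrow> op_norm N (jacobian g (at x) - jacobian g (at y)) \<le> \<omega> * N (x - y)\<rbrakk>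
      \<Longrightarrow> N (g z - g x - jacobian g (at x) *v (z - x)) \<le> K * \<omega> * (N (x - z))\<^sup>2"
proof -
  obtain C where C: "C > 0" "\<And>x. N x \<le> C * norm x"
    using is_norm_le_norm[OF assms] by blast
  obtain c where c: "c > 0" "\<And>x. norm x \<le> c * N x"
    using norm_le_is_norm[OF assms] by blast
  have bound: "N (g z - g x - jacobian g (at x) *v (z - x)) \<le> ((C * c)\<^sup>2) * \<omega> * (N (x - z))\<^sup>2"
    if diff: "\<And>y. g differentiable (at y)" and \<omega>: "\<omega> > 0" and x: "x \<in> ball_wrt N z r"
      and lip: "\<And>y. y \<in> ball_wrt N z r \<Longrightarrow>
        op_norm N (jacobian g (at x) - jacobian g (at y)) \<le> \<omega> * N (x - y)"
    for g :: "real ^ 'd \<Rightarrow> real ^ 'd" and \<omega> x z r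
  proof -
    define S where "S = (\<lambda>t. x + t *\<^sub>R (z - x)) ` {0..1}"
    define B where "B = c * (\<omega> * N (x - z) * C)"
    have deriv_bound: "onorm ((*v) (jacobian g (at y)) - (*v) (jacobian g (at x))) \<le> B"
      if y: "y \<in> S" for y
    proof (rule onorm_le)
      fix v
      obtain t where t: "0 \<le> t" "t \<le> 1" "y = x + t *\<^sub>R (z - x)"
        using y by (auto simp: S_def)
      have "y - z = (1 - t) *\<^sub>R (x - z)" "x - y = t *\<^sub>R (x - z)"
        by (simp_all add: t(3) algebra_simps)
      then have Nyz: "N (y - z) = (1 - t) * N (x - z)" and Nxy: "N (x - y) = t * N (x - z)"
        using t by (simp_all add: is_normD(3)[OF assms])
      have "N (y - z) \<le> N (x - z)" "N (x - y) \<le> N (x - z)"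
        unfolding Nyz Nxy using t is_normD(1)[OF assms, of "x - z"] by (simp_all add: mult_left_le_one_le)
      then have "op_norm N (jacobian g (at x) - jacobian g (at y)) \<le> \<omega> * N (x - z)"
        using lip[of y] x \<omega> by (smt (verit) ball_wrt_def mem_Collect_eq mult_left_mono)
      then have Nv: "N ((jacobian g (at x) - jacobian g (at y)) *v v) \<le> \<omega> * N (x - z) * N v"
        by (rule op_norm_bound_le[OF assms])
      have "norm (((*v) (jacobian g (at y)) - (*v) (jacobian g (at x))) v)
          = norm ((jacobian g (at x) - jacobian g (at y)) *v v)"
        by (simp add: matrix_vector_mult_diff_rdistrib norm_minus_commute)
      also have "\<dots> \<le> c * N ((jacobian g (at x) - jacobian g (at y)) *v v)" by (rule c)
      also have "\<dots> \<le> c * (\<omega> * N (x - z) * N v)"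
        using Nv c by simp
      also have "\<dots> \<le> c * (\<omega> * N (x - z) * (C * norm v))"
        using c \<omega> is_normD(1)[OF assms] C by (intro mult_left_mono) simp_all
      finally show "norm (((*v) (jacobian g (at y)) - (*v) (jacobian g (at x))) v) \<le> B * norm v"
        by (simp add: B_def ac_simps)
    qed
    have der: "(g has_derivative (*v) (jacobian g (at y))) (at y within S)" for y
      using diff[of y] by (simp add: jacobian_works has_derivative_at_withinI)
    have "norm (g z - g x - jacobian g (at x) *v (z - x)) \<le> norm (z - x) * B"
    proof (rule differentiable_bound_linearization[where S = S and f' = "\<lambda>y. (*v) (jacobian g (at y))"])
      show "x \<in> S" unfolding S_def by (rule image_eqI[of _ _ 0]) simp_all
    qed (use der deriv_bound in \<open>auto simp: S_def fun_diff_def\<close>)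
    also have "\<dots> \<le> (c * N (x - z)) * B"
      using c(2)[of "x - z"] c \<omega> C is_normD(1)[OF assms]
      by (intro mult_right_mono) (simp_all add: norm_minus_commute B_def)
    finally have "N (g z - g x - jacobian g (at x) *v (z - x)) \<le> C * ((c * N (x - z)) * B)"
      using C by (smt (verit) mult_left_mono)
    then show ?thesis
      by (simp add: B_def power2_eq_square ac_simps)
  qed
  have "(C * c)\<^sup>2 > 0" using C c by simp
  then show thesis using bound by (rule that)
qed

lemma matrix_inv_left:
  fixes A :: "'a::semiring_1 ^ 'n ^ 'm"
  assumes "invertible A"
  shows "matrix_inv A ** A = mat 1"
  using assms someI_ex[of "\<lambda>B. A ** B = mat 1 \<and> B ** A = mat 1"]
  unfolding invertible_def matrix_inv_def by blast

text \<open>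
  Writing \<open>x - z\<close> as the inverse applied to \<open>(\<alpha> R + g'(x)) (x - z)\<close> separates the part due
  to \<open>\<alpha> R\<close>, which has to be contracting by itself, from the Newton part, whose factor is
  proportional to the error.
\<close>

lemma regularized_newton_step:
  fixes g :: "real ^ 'd \<Rightarrow> real ^ 'd"
  assumes N: "is_norm N" and root: "g z = 0"
    and inv: "invertible (reg_jacobian g R \<alpha> x)"
    and M: "op_norm N (matrix_inv (reg_jacobian g R \<alpha> x)) \<le> M" "M \<ge> 0"
    and \<theta>: "op_norm N (matrix_inv (reg_jacobian g R \<alpha> x) ** (\<alpha> *\<^sub>R R)) \<le> \<theta>"
    and lin: "N (g z - g x - jacobian g (at x) *v (z - x)) \<le> L * (N (x - z))\<^sup>2"
    and step: "x' - x = - (matrix_inv (reg_jacobian g R \<alpha> x) *v g x)"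
  shows "N (x' - z) \<le> (\<theta> + M * L * N (x - z)) * N (x - z)"
proof -
  define T where "T = matrix_inv (reg_jacobian g R \<alpha> x)"
  define w where "w = g z - g x - jacobian g (at x) *v (z - x)"
  have "x' - z = (x - z) - T *v g x"
    using step by (simp add: T_def algebra_simps)
  also have "x - z = T *v (reg_jacobian g R \<alpha> x *v (x - z))"
    using matrix_inv_left[OF inv] by (simp add: T_def matrix_vector_mul_assoc)
  also have "T *v (reg_jacobian g R \<alpha> x *v (x - z)) - T *v g x
      = T *v (reg_jacobian g R \<alpha> x *v (x - z) - g x)"
    by (simp add: matrix_vector_mult_diff_distrib)
  also have "reg_jacobian g R \<alpha> x *v (x - z) - g x = (\<alpha> *\<^sub>R R) *v (x - z) + w"
    by (simp add: reg_jacobian_def w_def root algebra_simps)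
  also have "T *v ((\<alpha> *\<^sub>R R) *v (x - z) + w) = (T ** (\<alpha> *\<^sub>R R)) *v (x - z) + T *v w"
    by (simp only: matrix_vector_right_distrib matrix_vector_mul_assoc)
  finally have "x' - z = (T ** (\<alpha> *\<^sub>R R)) *v (x - z) + T *v w" .
  then have "N (x' - z) \<le> N ((T ** (\<alpha> *\<^sub>R R)) *v (x - z)) + N (T *v w)"
    using is_normD(4)[OF N] by simp
  also have "\<dots> \<le> \<theta> * N (x - z) + M * N w"
    unfolding T_def by (intro add_mono op_norm_bound_le N \<theta> M)
  also have "\<dots> \<le> \<theta> * N (x - z) + M * (L * (N (x - z))\<^sup>2)"
    using lin M(2) by (simp add: w_def mult_left_mono)
  finally show ?thesis
    by (simp add: algebra_simps power2_eq_square)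
qed

text \<open>
  A contraction that is known only on a ball suffices, because the contraction itself keeps the
  iterates in the ball.
\<close>

lemma q_linearly_converges_if_local_contraction:
  assumes N: "is_norm N" and \<rho>: "0 < \<rho>" "\<rho> < 1" and start: "X 0 \<in> ball_wrt N z \<epsilon>"
    and contr: "\<And>n. X n \<in> ball_wrt N z \<epsilon> \<Longrightarrow> N (X (Suc n) - z) \<le> \<rho> * N (X n - z)"
  shows "X n \<in> ball_wrt N z \<epsilon>" "q_linearly_converges N X z"
proof -
  have ball: "X n \<in> ball_wrt N z \<epsilon>" for n
  proof (induction n)
    case (Suc n)
    have "\<rho> * N (X n - z) \<le> N (X n - z)"
      using \<rho> is_normD(1)[OF N] by (simp add: mult_left_le_one_le)
    then show ?case using Suc contr[OF Suc] by (simp add: ball_wrt_def)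
  qed (rule start)
  then show "X n \<in> ball_wrt N z \<epsilon>" .
  have step: "N (X (Suc n) - z) \<le> \<rho> * N (X n - z)" for n
    using contr ball .
  have geom: "N (X n - z) \<le> \<rho> ^ n * N (X 0 - z)" for n
  proof (induction n)
    case (Suc n)
    then have "\<rho> * N (X n - z) \<le> \<rho> * (\<rho> ^ n * N (X 0 - z))"
      using \<rho> by simp
    then show ?case using step[of n] by simp
  qed simp
  have "(\<lambda>n. \<rho> ^ n * N (X 0 - z)) \<longlonglongrightarrow> 0"
    using \<rho> by (intro tendsto_mult_left_zero LIMSEQ_power_zero) simp
  then have "(\<lambda>n. N (X n - z)) \<longlonglongrightarrow> 0"
    by (rule tendsto_0_le[where K = 1]) (simp add: geom is_normD(1)[OF N] \<rho>(1) less_imp_le)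
  then show "q_linearly_converges N X z"
    unfolding q_linearly_converges_def using step \<rho> by blast
qed

theorem theorem4p2:
  fixes N :: "real ^ 'd \<Rightarrow> real"
    and g :: "real ^ 'd \<Rightarrow> real ^ 'd"
    and xs :: "real ^ 'd"
    and R :: "real ^ 'd ^ 'd"
    and \<alpha>\<^sub>M :: real
  assumes "is_norm N"
    and "\<And>x. g differentiable (at x)"
    and "g xs = 0"
    and "pos_semidef R"
    and "\<alpha>\<^sub>M > 0"
    and "\<exists>\<beta> \<omega>\<^sub>L M\<^sub>I \<epsilon>\<^sub>1. \<beta> > 0 \<and> \<omega>\<^sub>L > 0 \<and> M\<^sub>I > 0 \<and> \<epsilon>\<^sub>1 > 0 \<and>
      (\<forall>\<alpha> x. 0 < \<alpha> \<and> \<alpha> < \<alpha>\<^sub>M \<and> x \<in> ball_wrt N xs \<epsilon>\<^sub>1 \<longrightarrow>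
        (\<forall>y \<in> ball_wrt N xs \<epsilon>\<^sub>1.
           op_norm N (jacobian g (at x) - jacobian g (at y)) \<le> \<omega>\<^sub>L * N (x - y)) \<and>
        invertible (reg_jacobian g R \<alpha> x) \<and>
        op_norm N (matrix_inv (reg_jacobian g R \<alpha> x)) \<le> M\<^sub>I \<and>
        op_norm N (matrix_inv (reg_jacobian g R \<alpha> x) ** (\<alpha> *\<^sub>R R))
          \<le> (\<alpha> / \<beta>) / (1 + \<alpha> / \<beta>))"
  shows "\<exists>\<epsilon>\<^sub>E > 0. \<forall>x0 \<in> ball_wrt N xs \<epsilon>\<^sub>E.
    \<forall>\<alpha> :: nat \<Rightarrow> real. (\<forall>n. 0 < \<alpha> n \<and> \<alpha> n < \<alpha>\<^sub>M) \<longrightarrow>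
      (\<forall>X :: nat \<Rightarrow> real ^ 'd.
         X 0 = x0 \<and>
         (\<forall>n. X (Suc n) - X n = - (matrix_inv (reg_jacobian g R (\<alpha> n) (X n)) *v g (X n))) \<longrightarrow>
         (\<forall>n. invertible (reg_jacobian g R (\<alpha> n) (X n))) \<and>
         q_linearly_converges N X xs)"
proof -
  note N = assms(1) and diff = assms(2) and root = assms(3)
  obtain \<beta> \<omega> M \<epsilon>\<^sub>1 where pos: "\<beta> > 0" "\<omega> > 0" "M > 0" "\<epsilon>\<^sub>1 > 0"
    and lip: "\<And>\<alpha> x y. \<lbrakk>0 < \<alpha>; \<alpha> < \<alpha>\<^sub>M; x \<in> ball_wrt N xs \<epsilon>\<^sub>1; y \<in> ball_wrt N xs \<epsilon>\<^sub>1\<rbrakk> \<Longrightarrow>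
        op_norm N (jacobian g (at x) - jacobian g (at y)) \<le> \<omega> * N (x - y)"
    and inv: "\<And>\<alpha> x. \<lbrakk>0 < \<alpha>; \<alpha> < \<alpha>\<^sub>M; x \<in> ball_wrt N xs \<epsilon>\<^sub>1\<rbrakk> \<Longrightarrow>
        invertible (reg_jacobian g R \<alpha> x)"
    and inv_bound: "\<And>\<alpha> x. \<lbrakk>0 < \<alpha>; \<alpha> < \<alpha>\<^sub>M; x \<in> ball_wrt N xs \<epsilon>\<^sub>1\<rbrakk> \<Longrightarrow>
        op_norm N (matrix_inv (reg_jacobian g R \<alpha> x)) \<le> M"
    and reg_bound: "\<And>\<alpha> x. \<lbrakk>0 < \<alpha>; \<alpha> < \<alpha>\<^sub>M; x \<in> ball_wrt N xs \<epsilon>\<^sub>1\<rbrakk> \<Longrightarrow>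
        op_norm N (matrix_inv (reg_jacobian g R \<alpha> x) ** (\<alpha> *\<^sub>R R)) \<le> (\<alpha> / \<beta>) / (1 + \<alpha> / \<beta>)"
    using assms(6) by (elim exE conjE) (rule that; blast)
  obtain K where K: "K > 0"
    and quadratic: "\<And>(g :: real ^ 'd \<Rightarrow> real ^ 'd) \<omega> x z r.
      \<lbrakk>\<And>y. g differentiable (at y); \<omega> > 0; x \<in> ball_wrt N z r;
       \<And>y. y \<in> ball_wrt N z r \<Longrightarrow> op_norm N (jacobian g (at x) - jacobian g (at y)) \<le> \<omega> * N (x - y)\<rbrakk>
      \<Longrightarrow> N (g z - g x - jacobian g (at x) *v (z - x)) \<le> K * \<omega> * (N (x - z))\<^sup>2"
    using linearization_error_quadratic[OF N] by blast
  define \<theta> where "\<theta> = \<alpha>\<^sub>M / (\<alpha>\<^sub>M + \<beta>)"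
  have \<theta>: "0 < \<theta>" "\<theta> < 1"
    using pos assms(5) by (simp_all add: \<theta>_def)
  have \<theta>_bound: "(\<alpha> / \<beta>) / (1 + \<alpha> / \<beta>) \<le> \<theta>" if "0 < \<alpha>" "\<alpha> < \<alpha>\<^sub>M" for \<alpha>
  proof -
    have "(\<alpha> / \<beta>) / (1 + \<alpha> / \<beta>) = \<alpha> / (\<alpha> + \<beta>)"
      using pos that by (simp add: field_simps)
    \<comment> \<open>The function \<open>t / (t + \<beta>)\<close> increases in \<open>t\<close>.\<close>
    also have "\<dots> \<le> \<theta>"
      using pos that by (simp add: \<theta>_def frac_le_eq divide_le_eq field_simps)
    finally show ?thesis .
  qed
  define L where "L = M * (K * \<omega>)"
  define \<rho> where "\<rho> = (1 + \<theta>) / 2"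
  define \<epsilon> where "\<epsilon> = min \<epsilon>\<^sub>1 ((1 - \<theta>) / (2 * L))"
  have L: "L > 0" using K pos by (simp add: L_def)
  have \<rho>: "0 < \<rho>" "\<rho> < 1" using \<theta> by (simp_all add: \<rho>_def)
  have \<epsilon>: "\<epsilon> > 0" using \<theta> L pos by (simp add: \<epsilon>_def)
  have sub: "x \<in> ball_wrt N xs \<epsilon>\<^sub>1" if "x \<in> ball_wrt N xs \<epsilon>" for x
    using that by (simp add: ball_wrt_def \<epsilon>_def)
  have contr: "N (x' - xs) \<le> \<rho> * N (x - xs)"
    if \<alpha>: "0 < \<alpha>" "\<alpha> < \<alpha>\<^sub>M" and x: "x \<in> ball_wrt N xs \<epsilon>"
      and step: "x' - x = - (matrix_inv (reg_jacobian g R \<alpha> x) *v g x)" for \<alpha> x x'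
  proof -
    note args = \<alpha> sub[OF x]
    have "N (x' - xs) \<le> (\<theta> + M * (K * \<omega>) * N (x - xs)) * N (x - xs)"
    proof (rule regularized_newton_step[OF N root inv[OF args] inv_bound[OF args] _ _ _ step])
      show "op_norm N (matrix_inv (reg_jacobian g R \<alpha> x) ** (\<alpha> *\<^sub>R R)) \<le> \<theta>"
        using reg_bound[OF args] \<theta>_bound[OF \<alpha>] by linarith
      show "N (g xs - g x - jacobian g (at x) *v (xs - x)) \<le> K * \<omega> * (N (x - xs))\<^sup>2"
        by (rule quadratic[OF diff pos(2) sub[OF x]]) (rule lip[OF args])
    qed (use pos in simp)
    also have "\<dots> \<le> \<rho> * N (x - xs)"
    proof (rule mult_right_mono[OF _ is_normD(1)[OF N]])
      have "N (x - xs) \<le> (1 - \<theta>) / (2 * L)"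
        using x by (simp add: ball_wrt_def \<epsilon>_def)
      then have "N (x - xs) * L \<le> (1 - \<theta>) / 2"
        using L by (simp add: field_simps)
      moreover have "M * (K * \<omega>) * N (x - xs) = N (x - xs) * L"
        by (simp only: L_def mult.commute)
      moreover have "\<theta> + (1 - \<theta>) / 2 = \<rho>"
        by (simp add: \<rho>_def field_simps)
      ultimately show "\<theta> + M * (K * \<omega>) * N (x - xs) \<le> \<rho>"
        by (metis add_left_mono)
    qed
    finally show ?thesis .
  qed
  show ?thesis
  proof (intro exI[of _ \<epsilon>] conjI ballI allI impI; (elim conjE)?)
    fix x0 \<alpha> X n
    assume x0: "x0 \<in> ball_wrt N xs \<epsilon>" "X 0 = x0" and \<alpha>: "\<forall>n. 0 < \<alpha> n \<and> \<alpha> n < \<alpha>\<^sub>M"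
      and step: "\<forall>n. X (Suc n) - X n = - (matrix_inv (reg_jacobian g R (\<alpha> n) (X n)) *v g (X n))"
    have "N (X (Suc n) - xs) \<le> \<rho> * N (X n - xs)" if "X n \<in> ball_wrt N xs \<epsilon>" for n
      using contr[OF _ _ that] \<alpha> step by blast
    note conv = q_linearly_converges_if_local_contraction[OF N \<rho> x0(1)[folded x0(2)] this]
    show "q_linearly_converges N X xs" by (rule conv(2))
    show "invertible (reg_jacobian g R (\<alpha> n) (X n))"
      using inv \<alpha> sub[OF conv(1)] by blast
  qed (rule \<epsilon>)
qed

end
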